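(* Let $\mathcal{A}$ be an adequate family of finite subsets of $\mathbb{N}$. Then the following are equivalent: (i) $\{A\in\mathcal{A} : i\in A\}$ is finite for all $i\in\mathbb{N}$; (ii) $h_{\mathcal{A},1}$ is (I)-polyhedral; (iii) $h_{\mathcal{A},1}$ is (IV)-polyhedral.
   Context: All Banach spaces are real. $B_X$, $S_X$, $X^*$ denote the closed unit ball, unit sphere and topological dual of a Banach space $X$; $\operatorname{ext} B_{X^*}$ is the set of extreme points of $B_{X^*}$. Adequate family: a family $\mathcal{A}$ of subsets of $\mathbb{N}=\{1,2,\dots\}$ is adequate if (1) it contains the empty set and all singletons $\{i\}$, $i\in\mathbb{N}$; (2) it is hereditary: $A\in\mathcal{A}$ and $B\subseteq A$ imply $B\in\mathcal{A}$; (3) it is compact for pointwise convergence, i.e. given $A\subset\mathbb{N}$, if every finite subset of $A$ is in $\mathcal{A}$, then $A\in\mathcal{A}$. An adequate family of finite subsets is one all of whose members are finite. The space $h_{\mathcal{A},1}$: the completion of the space $c_{00}$ of finitely supported sequences, with standard basis $(e_i)_{i\in\mathbb{N}}$, in the norm $\left\|\sum_{i=1}^n a_i e_i\right\| = \sup_{A\in\mathcal{A}}\sum_{i\in A}|a_i|$ (with $a_i=0$ for $i>n$). For a set $E\subset X^*$, $E'=\{f\in X^* : f\in\overline{E\setminus\{f\}}^{w^*}\}$ denotes its set of $w^*$-limit points. A Banach space $X$ is (I)-polyhedral if $(\operatorname{ext}B_{X^*})'\subseteq\{0\}$; it is (IV)-polyhedral if $f(x)<1$ whenever $x\in S_X$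 and $f\in(\operatorname{ext}B_{X^*})'$. *)

theory Defs
  imports "HOL-Analysis.Analysis" "HOL-Library.Function_Algebras"
begin

section \<open>Pointwise vector space structure on functions\<close>

text \<open>Both \<open>c\<^sub>0\<^sub>0\<close> and the dual of a Banach space are sets of functions with pointwise operations.
  Addition is already provided by \<open>Function_Algebras\<close>.\<close>

instantiation "fun" :: (type, real_vector) real_vector
begin

definition scaleR_fun_def: "c *\<^sub>R f = (\<lambda>x. c *\<^sub>R f x)" for f :: "'a \<Rightarrow> 'b"

instance
  by standard (simp_all add: scaleR_fun_def fun_eq_iff plus_fun_def algebra_simps)

end

definition linear_on :: "'a::real_vector set \<Rightarrow> ('a \<Rightarrow> 'b::real_vector) \<Rightarrow> bool" where
  "linear_on V f \<longleftrightarrow>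
     (\<forall>x\<in>V. \<forall>y\<in>V. f (x + y) = f x + f y) \<and> (\<forall>c. \<forall>x\<in>V. f (c *\<^sub>R x) = c *\<^sub>R f x)"


section \<open>The dual of a Banach space and polyhedrality\<close>

text \<open>A Banach space is given here as a complete linear subspace \<open>X\<close> of a normed type, with the
  induced norm, so that spaces depending on term parameters can be treated; \<open>X = UNIV\<close> gives the
  type itself.  A functional on \<open>X\<close> is represented by the function that agrees with it on \<open>X\<close> and
  is \<open>0\<close> outside \<open>X\<close>.  This makes the representation unique, and the vector space operations of
  the dual become the pointwise ones.\<close>

definition dual :: "'v::real_normed_vector set \<Rightarrow> ('v \<Rightarrow> real) set" where
  "dual X = {f. (\<forall>x. x \<notin> X \<longrightarrow> f x = 0) \<and> linear_on X f \<and> (\<exists>C. \<forall>x\<in>X. \<bar>f x\<bar> \<le> C * norm x)}"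

definition dual_ball :: "'v::real_normed_vector set \<Rightarrow> ('v \<Rightarrow> real) set" where
  "dual_ball X = {f \<in> dual X. \<forall>x\<in>X. \<bar>f x\<bar> \<le> norm x}"

text \<open>The weak* topology is that of pointwise convergence on \<open>X\<close>; the points outside \<open>X\<close> impose
  no condition since all members of \<open>dual X\<close> vanish there.\<close>

definition weak_star :: "'v::real_normed_vector set \<Rightarrow> ('v \<Rightarrow> real) topology" where
  "weak_star X = subtopology (powertop_real UNIV) (dual X)"

definition ext_dual_ball :: "'v::real_normed_vector set \<Rightarrow> ('v \<Rightarrow> real) set" where
  "ext_dual_ball X = {f. f extreme_point_of dual_ball X}"

definition I_polyhedral :: "'v::real_normed_vector set \<Rightarrow> bool" where
  "I_polyhedral X \<longleftrightarrow> weak_star X derived_set_of ext_dual_ball X \<subseteq> {0}"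

definition IV_polyhedral :: "'v::real_normed_vector set \<Rightarrow> bool" where
  "IV_polyhedral X \<longleftrightarrow>
     (\<forall>x \<in> X \<inter> sphere 0 1. \<forall>f \<in> weak_star X derived_set_of ext_dual_ball X. f x < 1)"


section \<open>Adequate families and their sequence spaces\<close>

text \<open>The index set is the whole type \<^typ>\<open>nat\<close>, that is, the indices \<open>1, 2, \<dots>\<close> are renumbered
  \<open>0, 1, \<dots>\<close>.\<close>

definition adequate :: "nat set set \<Rightarrow> bool" where
  "adequate \<A> \<longleftrightarrow>
     {} \<in> \<A> \<and> (\<forall>i. {i} \<in> \<A>) \<and>
     (\<forall>A\<in>\<A>. \<forall>B. B \<subseteq> A \<longrightarrow> B \<in> \<A>) \<and>
     (\<forall>A. (\<forall>F. F \<subseteq> A \<and> finite F \<longrightarrow> F \<in> \<A>) \<longrightarrow> A \<in> \<A>)"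

definition c00 :: "(nat \<Rightarrow> real) set" where
  "c00 = {a. finite {i. a i \<noteq> 0}}"

text \<open>The sum is restricted to the support of \<open>a\<close> since members of \<open>\<A>\<close> may be infinite.\<close>

definition h1_norm :: "nat set set \<Rightarrow> (nat \<Rightarrow> real) \<Rightarrow> real" where
  "h1_norm \<A> a = (SUP A\<in>\<A>. \<Sum>i\<in>{i\<in>A. a i \<noteq> 0}. \<bar>a i\<bar>)"

definition is_completion ::
  "'a::real_vector set \<Rightarrow> ('a \<Rightarrow> real) \<Rightarrow> ('a \<Rightarrow> 'v::real_normed_vector) \<Rightarrow> 'v set \<Rightarrow> bool" where
  "is_completion V N j X \<longleftrightarrow>
     linear_on V j \<and> (\<forall>a\<in>V. norm (j a) = N a) \<and> complete X \<and> closure (j ` V) = X"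

text \<open>\<open>X\<close> is (a copy of) the space \<open>h\<^bsub>\<A>,1\<^esub>\<close>, with \<open>j\<close> the canonical embedding of \<open>c\<^sub>0\<^sub>0\<close>.\<close>

definition is_h1 ::
  "nat set set \<Rightarrow> ((nat \<Rightarrow> real) \<Rightarrow> 'v::real_normed_vector) \<Rightarrow> 'v set \<Rightarrow> bool" where
  "is_h1 \<A> j X \<longleftrightarrow> is_completion c00 (h1_norm \<A>) j X"


subsection \<open>Existence\<close>

text \<open>For every adequate family such a completion exists, in a type not depending on the family:
  \<open>h\<^bsub>\<A>,1\<^esub>\<close> embeds isometrically into the space of bounded sequences by means of the functionals
  \<open>a \<mapsto> \<Sum>i\<in>P. a i - \<Sum>i\<in>Q. a i\<close>, where \<open>P\<close> and \<open>Q\<close> are finite and disjoint with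
  \<open>P \<union> Q \<in> \<A>\<close>.\<close>

definition h1_coeff :: "nat set set \<Rightarrow> nat \<Rightarrow> nat \<Rightarrow> real" where
  "h1_coeff \<A> k i =
     (let P = set_decode (fst (prod_decode k)); Q = set_decode (snd (prod_decode k))
      in if P \<inter> Q = {} \<and> P \<union> Q \<in> \<A> then of_bool (i \<in> P) - of_bool (i \<in> Q) else 0)"

definition h1_embed :: "nat set set \<Rightarrow> (nat \<Rightarrow> real) \<Rightarrow> nat \<Rightarrow>\<^sub>C real" where
  "h1_embed \<A> a = Bcontfun (\<lambda>k. \<Sum>i | a i \<noteq> 0. h1_coeff \<A> k i * a i)"

lemma abs_h1_coeff_le: "\<bar>h1_coeff \<A> k i\<bar> \<le> 1"
  by (auto simp: h1_coeff_def Let_def)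

lemma h1_embed_apply:
  "apply_bcontfun (h1_embed \<A> a) k = (\<Sum>i | a i \<noteq> 0. h1_coeff \<A> k i * a i)"
proof -
  have "\<bar>\<Sum>i | a i \<noteq> 0. h1_coeff \<A> k i * a i\<bar> \<le> (\<Sum>i | a i \<noteq> 0. \<bar>a i\<bar>)" for k
    by (rule order_trans[OF sum_abs], rule sum_mono)
      (simp add: abs_mult abs_h1_coeff_le mult_left_le_one_le)
  then have "(\<lambda>k. \<Sum>i | a i \<noteq> 0. h1_coeff \<A> k i * a i) \<in> bcontfun"
    unfolding bcontfun_def by (auto simp: bounded_iff)
  then show ?thesis
    by (simp add: h1_embed_def Bcontfun_inverse)
qed

lemma h1_embed_apply_superset:
  assumes "finite S" "{i. a i \<noteq> 0} \<subseteq> S"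
  shows "apply_bcontfun (h1_embed \<A> a) k = (\<Sum>i\<in>S. h1_coeff \<A> k i * a i)"
  unfolding h1_embed_apply using assms by (intro sum.mono_neutral_left) auto

lemma linear_on_h1_embed: "linear_on c00 (h1_embed \<A>)"
  unfolding linear_on_def
proof (intro conjI ballI allI)
  fix a b assume ab: "a \<in> c00" "b \<in> c00"
  let ?S = "{i. a i \<noteq> 0} \<union> {i. b i \<noteq> 0}"
  have fin: "finite ?S" using ab by (auto simp: c00_def)
  show "h1_embed \<A> (a + b) = h1_embed \<A> a + h1_embed \<A> b"
  proof (rule bcontfun_eqI)
    fix k
    show "apply_bcontfun (h1_embed \<A> (a + b)) k = apply_bcontfun (h1_embed \<A> a + h1_embed \<A> b) k"
      unfolding plus_bcontfun.rep_eq
      by (subst (1 2 3) h1_embed_apply_superset[OF fin])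
        (auto simp: algebra_simps sum.distrib)
  qed
next
  fix c :: real and a assume a: "a \<in> c00"
  then have fin: "finite {i. a i \<noteq> 0}" by (simp add: c00_def)
  show "h1_embed \<A> (c *\<^sub>R a) = c *\<^sub>R h1_embed \<A> a"
  proof (rule bcontfun_eqI)
    fix k
    show "apply_bcontfun (h1_embed \<A> (c *\<^sub>R a)) k = apply_bcontfun (c *\<^sub>R h1_embed \<A> a) k"
      unfolding scaleR_bcontfun.rep_eq
      by (subst (1 2) h1_embed_apply_superset[OF fin])
        (auto simp: scaleR_fun_def algebra_simps sum_distrib_left)
  qed
qed

lemma h1_sum_le_norm:
  assumes "a \<in> c00" "A \<in> \<A>"
  shows "(\<Sum>i\<in>{i\<in>A. a i \<noteq> 0}. \<bar>a i\<bar>) \<le> h1_norm \<A> a"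
  unfolding h1_norm_def
proof (rule cSUP_upper[OF assms(2)], rule bdd_aboveI2)
  fix B
  show "(\<Sum>i\<in>{i\<in>B. a i \<noteq> 0}. \<bar>a i\<bar>) \<le> (\<Sum>i | a i \<noteq> 0. \<bar>a i\<bar>)"
    using assms(1) by (intro sum_mono2) (auto simp: c00_def)
qed

lemma norm_h1_embed:
  assumes ad: "adequate \<A>" and a: "a \<in> c00"
  shows "norm (h1_embed \<A> a) = h1_norm \<A> a"
proof (rule antisym)
  have fin: "finite {i. a i \<noteq> 0}" using a by (simp add: c00_def)
  have ne: "{} \<in> \<A>" using ad by (simp add: adequate_def)
  have nonneg: "0 \<le> h1_norm \<A> a"
    using h1_sum_le_norm[OF a ne] by simp
  show "norm (h1_embed \<A> a) \<le> h1_norm \<A> a"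
  proof (rule norm_bound)
    fix k
    define P where "P = set_decode (fst (prod_decode k))"
    define Q where "Q = set_decode (snd (prod_decode k))"
    show "norm (apply_bcontfun (h1_embed \<A> a) k) \<le> h1_norm \<A> a"
    proof (cases "P \<inter> Q = {} \<and> P \<union> Q \<in> \<A>")
      case True
      have "\<bar>\<Sum>i | a i \<noteq> 0. h1_coeff \<A> k i * a i\<bar> \<le> (\<Sum>i | a i \<noteq> 0. \<bar>h1_coeff \<A> k i * a i\<bar>)"
        by (rule sum_abs)
      also have "\<dots> \<le> (\<Sum>i | a i \<noteq> 0. if i \<in> P \<union> Q then \<bar>a i\<bar> else 0)"
        using True by (intro sum_mono) (auto simp: h1_coeff_def Let_def P_def Q_def)
      also have "\<dots> = (\<Sum>i\<in>{i\<in>P \<union> Q. a i \<noteq> 0}. \<bar>a i\<bar>)"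
        using fin by (simp add: sum.If_cases Int_def conj_commute)
      also have "\<dots> \<le> h1_norm \<A> a"
        using True by (intro h1_sum_le_norm a) auto
      finally show ?thesis by (simp add: h1_embed_apply)
    next
      case False
      then have "h1_coeff \<A> k i = 0" for i
        by (auto simp: h1_coeff_def Let_def P_def Q_def)
      then show ?thesis using nonneg by (simp add: h1_embed_apply)
    qed
  qed
  show "h1_norm \<A> a \<le> norm (h1_embed \<A> a)"
    unfolding h1_norm_def
  proof (rule cSUP_least)
    show "\<A> \<noteq> {}" using ne by auto
  next
    fix A assume A: "A \<in> \<A>"
    define P where "P = {i\<in>A. a i > 0}"
    define Q where "Q = {i\<in>A. a i < 0}"
    define k where "k = prod_encode (set_encode P, set_encode Q)"
    have finPQ: "finite P" "finite Q"
      by (auto intro: finite_subset[OF _ fin] simp: P_def Q_def)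
    have "P \<union> Q \<subseteq> A" by (auto simp: P_def Q_def)
    with ad A have PQ: "P \<union> Q \<in> \<A>" unfolding adequate_def by blast
    have "P \<inter> Q = {}" by (auto simp: P_def Q_def)
    then have coeff: "h1_coeff \<A> k i = of_bool (i \<in> P) - of_bool (i \<in> Q)" for i
      using PQ finPQ by (simp add: h1_coeff_def k_def)
    have "(\<Sum>i\<in>{i\<in>A. a i \<noteq> 0}. \<bar>a i\<bar>) = (\<Sum>i\<in>{i\<in>A. a i \<noteq> 0}. h1_coeff \<A> k i * a i)"
      by (intro sum.cong) (auto simp: coeff P_def Q_def)
    also have "\<dots> = apply_bcontfun (h1_embed \<A> a) k"
      unfolding h1_embed_apply using fin
      by (intro sum.mono_neutral_left) (auto simp: coeff P_def Q_def)
    also have "\<dots> \<le> norm (h1_embed \<A> a)"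
      using norm_bounded[of "h1_embed \<A> a" k] by simp
    finally show "(\<Sum>i\<in>{i\<in>A. a i \<noteq> 0}. \<bar>a i\<bar>) \<le> norm (h1_embed \<A> a)" .
  qed
qed

text \<open>The library shows completeness of \<open>'a \<Rightarrow>\<^sub>C 'b\<close> only for a metric space \<open>'a\<close>, and
  \<^typ>\<open>nat\<close> is no instance of that class.\<close>

lemma complete_UNIV_nat_bcontfun: "complete (UNIV :: (nat \<Rightarrow>\<^sub>C real) set)"
  unfolding complete_def
proof (intro allI impI)
  fix f :: "nat \<Rightarrow> nat \<Rightarrow>\<^sub>C real"
  assume "(\<forall>n. f n \<in> UNIV) \<and> Cauchy f"
  then obtain g where "uniform_limit UNIV (\<lambda>n. apply_bcontfun (f n)) g sequentially"
    using uniformly_convergent_eq_cauchy[of "\<lambda>_. True" "\<lambda>n. apply_bcontfun (f n)"]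
    unfolding Cauchy_def uniform_limit_sequentially_iff
    by (metis dist_fun_lt_imp_dist_val_lt)
  from uniform_limit_bcontfunE[OF this sequentially_bot]
  obtain l where "f \<longlonglongrightarrow> l" by metis
  then show "\<exists>l\<in>UNIV. f \<longlonglongrightarrow> l" by blast
qed

lemma is_h1_exists:
  assumes "adequate \<A>"
  shows "is_h1 \<A> (h1_embed \<A>) (closure (h1_embed \<A> ` c00))"
  unfolding is_h1_def is_completion_def
  by (simp add: linear_on_h1_embed norm_h1_embed[OF assms]
      complete_closed_subset[OF closed_closure subset_UNIV complete_UNIV_nat_bcontfun])

end

theory Submission
  imports Defs
begin

text \<open>Write \<open>b\<^sub>i\<close> for the image of the \<open>i\<close>-th unit sequence. A Milman-type argument shows that every
  extreme point \<open>f\<close> of the dual ball has coordinates \<open>f(b\<^sub>i) \<in> {-1, 0, 1}\<close>: the ball is the convex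
  hull of its two compact convex pieces \<open>f(b\<^sub>i) \<le> 0\<close> and \<open>f(b\<^sub>i) = 1\<close>, and likewise with the sign
  reversed. Hence the support of \<open>f\<close> is a member of the family. If only finitely many members contain
  \<open>i\<close>, then only finitely many extreme points do not vanish at \<open>b\<^sub>i\<close>, so \<open>0\<close> is the only possible
  weak* limit point. Conversely, infinitely many members containing \<open>i\<close> yield infinitely many maximal
  ones; their indicators are extreme points, and any weak* limit point of these indicators takes the
  value \<open>1\<close> at the unit vector \<open>b\<^sub>i\<close>.\<close>

section \<open>Dual balls of subspaces of a normed space\<close>

lemma scaleR_fun_apply [simp]: "(c *\<^sub>R f) x = c *\<^sub>R f x" for f :: "'a \<Rightarrow> 'b::real_vector"
  by (simp add: scaleR_fun_def)

section \<open>Maps that are linear on a subspace\<close>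

lemma linear_on_add: "linear_on V f \<Longrightarrow> x \<in> V \<Longrightarrow> y \<in> V \<Longrightarrow> f (x + y) = f x + f y"
  by (simp add: linear_on_def)

lemma linear_on_scaleR: "linear_on V f \<Longrightarrow> x \<in> V \<Longrightarrow> f (c *\<^sub>R x) = c *\<^sub>R f x"
  by (simp add: linear_on_def)

lemma linear_on_zero: "linear_on V f \<Longrightarrow> 0 \<in> V \<Longrightarrow> f 0 = 0"
  using linear_on_scaleR[of V f 0 0] by simp

lemma linear_on_diff:
  assumes "subspace V" "linear_on V f" "x \<in> V" "y \<in> V"
  shows "f (x - y) = f x - f y"
  using linear_on_add[OF assms(2) assms(3), of "(-1) *\<^sub>R y"]
    linear_on_scaleR[OF assms(2) assms(4), of "-1"] subspace_scale[OF assms(1) assms(4), of "-1"]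
  by simp

lemma linear_on_sum:
  assumes "subspace V" "linear_on V f" "\<And>i. i \<in> S \<Longrightarrow> g i \<in> V"
  shows "f (\<Sum>i\<in>S. g i) = (\<Sum>i\<in>S. f (g i))"
proof (cases "finite S")
  case True
  then show ?thesis using assms(3)
  proof (induction S)
    case empty
    then show ?case using assms by (simp add: linear_on_zero subspace_0)
  next
    case (insert x S)
    then show ?case
      using linear_on_add[OF assms(2), of "g x" "\<Sum>i\<in>S. g i"] subspace_sum[OF assms(1), of S g]
      by simp
  qed
next
  case False
  then show ?thesis using assms by (simp add: linear_on_zero subspace_0)
qed

lemma subspace_linear_on_image:
  assumes "subspace V" "linear_on V f"
  shows "subspace (f ` V)"
  unfolding subspace_def
proof (intro conjI ballI allI)
  show "0 \<in> f ` V"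
    using linear_on_zero[OF assms(2)] subspace_0[OF assms(1)] by (metis image_eqI)
  show "x + y \<in> f ` V" if "x \<in> f ` V" "y \<in> f ` V" for x y
    using that linear_on_add[OF assms(2)] subspace_add[OF assms(1)] by (metis (no_types) imageE imageI)
  show "c *\<^sub>R x \<in> f ` V" if "x \<in> f ` V" for c x
    using that linear_on_scaleR[OF assms(2)] subspace_scale[OF assms(1)]
    by (metis (no_types) imageE imageI)
qed

lemma subspace_closure:
  fixes V :: "'a::real_normed_vector set"
  assumes "subspace V"
  shows "subspace (closure V)"
  unfolding subspace_def
proof (intro conjI ballI allI)
  show "0 \<in> closure V" using assms closure_subset subspace_0 by blast
next
  fix x y assume "x \<in> closure V" "y \<in> closure V"
  then obtain s t where "\<And>n. s n \<in> V" "s \<longlonglongrightarrow> x" "\<And>n. t n \<in> V" "t \<longlonglongrightarrow> y"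
    by (metis closure_sequential)
  then show "x + y \<in> closure V"
    unfolding closure_sequential using assms
    by (intro exI[of _ "\<lambda>n. s n + t n"]) (auto intro: tendsto_add subspace_add)
next
  fix c x assume "x \<in> closure V"
  then obtain s where "\<And>n. s n \<in> V" "s \<longlonglongrightarrow> x"
    by (metis closure_sequential)
  then show "c *\<^sub>R x \<in> closure V"
    unfolding closure_sequential using assms
    by (intro exI[of _ "\<lambda>n. c *\<^sub>R s n"]) (auto intro: tendsto_scaleR subspace_scale)
qed

section \<open>Convexity and weak* compactness of the dual ball\<close>

lemma dual_ballI:
  assumes "\<And>x. x \<notin> X \<Longrightarrow> f x = 0" "linear_on X f" "\<And>x. x \<in> X \<Longrightarrow> \<bar>f x\<bar> \<le> norm x"
  shows "f \<in> dual_ball X"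
  unfolding dual_ball_def dual_def using assms by (auto intro!: exI[of _ 1])

lemma dual_ballD:
  assumes "f \<in> dual_ball X"
  shows "f \<in> dual X" "linear_on X f" "x \<notin> X \<Longrightarrow> f x = 0" "x \<in> X \<Longrightarrow> \<bar>f x\<bar> \<le> norm x"
  using assms by (auto simp: dual_ball_def dual_def)

lemma dual_ball_abs_le: "f \<in> dual_ball X \<Longrightarrow> \<bar>f x\<bar> \<le> norm x"
  by (cases "x \<in> X") (auto dest: dual_ballD)

lemma convex_dual_ball: "convex (dual_ball X)"
  unfolding convex_alt
proof (intro ballI allI impI)
  fix f g and u :: real assume fg: "f \<in> dual_ball X" "g \<in> dual_ball X" and u: "0 \<le> u \<and> u \<le> 1"
  show "(1 - u) *\<^sub>R f + u *\<^sub>R g \<in> dual_ball X"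
  proof (rule dual_ballI)
    show "linear_on X ((1 - u) *\<^sub>R f + u *\<^sub>R g)"
      using dual_ballD(2)[OF fg(1)] dual_ballD(2)[OF fg(2)]
      by (auto simp: linear_on_def algebra_simps)
    show "\<bar>((1 - u) *\<^sub>R f + u *\<^sub>R g) x\<bar> \<le> norm x" if "x \<in> X" for x
    proof -
      have "\<bar>(1 - u) * f x + u * g x\<bar> \<le> (1 - u) * norm x + u * norm x"
        using u dual_ball_abs_le[OF fg(1), of x] dual_ball_abs_le[OF fg(2), of x]
        by (intro order_trans[OF abs_triangle_ineq[of "(1 - u) * f x" "u * g x"]] add_mono)
          (auto simp: abs_mult mult_left_mono)
      then show ?thesis by (simp add: algebra_simps)
    qed
  qed (use fg in \<open>simp add: dual_ballD(3)\<close>)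
qed

lemma continuous_on_eval:
  "continuous_on S (\<lambda>f :: 'a \<Rightarrow> 'b::topological_space. f x)"
  by (rule continuous_on_subset[OF continuous_on_product_coordinates subset_UNIV])

text \<open>Banach-Alaoglu by way of Tychonoff: the ball sits in a product of compact intervals, and
  vanishing off \<open>X\<close>, additivity and homogeneity each compare finitely many coordinates,
  so they cut out closed sets.\<close>

lemma compact_dual_ball: "compact (dual_ball X)"
proof -
  have "compact (\<Pi>\<^sub>E x\<in>UNIV. {- norm x..norm x})"
    using compactin_PiE[of "\<lambda>_. euclideanreal" "UNIV" "\<lambda>x. {- norm x..norm x}"]
    by (simp add: euclidean_product_topology)
  moreover have "closed ((\<Inter>x\<in>-X. {f. f x = (0::real)}) \<inter> (\<Inter>x\<in>X. \<Inter>y\<in>X. {f. f (x + y) = f x + f y}) \<inter>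
      (\<Inter>c. \<Inter>x\<in>X. {f. f (c *\<^sub>R x) = c *\<^sub>R f x}))" (is "closed ?S")
    by (intro closed_Int closed_INT ballI closed_Collect_eq continuous_on_add continuous_on_scaleR
        continuous_on_const continuous_on_eval)
  ultimately have "compact ((\<Pi>\<^sub>E x\<in>UNIV. {- norm x..norm x}) \<inter> ?S)"
    by (rule compact_Int_closed)
  moreover have "(\<Pi>\<^sub>E x\<in>UNIV. {- norm x..norm x}) \<inter> ?S = dual_ball X"
  proof (intro equalityI subsetI)
    fix f assume "f \<in> (\<Pi>\<^sub>E x\<in>UNIV. {- norm x..norm x}) \<inter> ?S"
    then show "f \<in> dual_ball X"
      by (intro dual_ballI) (auto simp: PiE_iff abs_le_iff minus_le_iff linear_on_def)
  next
    fix f assume f: "f \<in> dual_ball X"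
    then have "- norm x \<le> f x \<and> f x \<le> norm x" for x
      using dual_ball_abs_le[OF f, of x] by (simp add: abs_le_iff minus_le_iff)
    with f show "f \<in> (\<Pi>\<^sub>E x\<in>UNIV. {- norm x..norm x}) \<inter> ?S"
      using dual_ballD(2)[OF f] by (auto simp: dual_ballD(3) linear_on_def)
  qed
  ultimately show ?thesis by simp
qed

lemma Hausdorff_space_weak_star: "Hausdorff_space (weak_star X)"
  unfolding weak_star_def
  by (intro Hausdorff_space_subtopology) (simp add: Hausdorff_space_product_topology)

lemma topspace_weak_star: "topspace (weak_star X) = dual X"
  by (simp add: weak_star_def)

lemma compactin_weak_star_dual_ball: "compactin (weak_star X) (dual_ball X)"
  using compact_dual_ball[of X]
  by (auto simp: weak_star_def compactin_subtopology euclidean_product_topology dual_ball_def)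

text \<open>Supplies the neighbourhoods, cut out by the value at a single point, with which limit
  points are tested.\<close>

lemma openin_weak_star_eval:
  assumes "open U"
  shows "openin (weak_star X) {f \<in> dual X. f x \<in> U}"
proof -
  have "open {f :: 'a \<Rightarrow> real. \<forall>i\<in>{()}. f x \<in> U}"
    using product_topology_basis'[of "{()}" "\<lambda>_. U" "\<lambda>_. x"] assms by simp
  then have "openin (powertop_real UNIV) {f. f x \<in> U}" by (simp add: open_fun_def)
  then show ?thesis unfolding weak_star_def
    by (auto simp: openin_subtopology)
qed

section \<open>Uniqueness and extension of functionals from a dense subspace\<close>

lemma dual_bounded:
  assumes "f \<in> dual X"
  obtains C where "C \<ge> 0" "\<And>x. x \<in> X \<Longrightarrow> \<bar>f x\<bar> \<le> C * norm x"
proof -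
  from assms obtain C where C: "\<forall>x\<in>X. \<bar>f x\<bar> \<le> C * norm x" by (auto simp: dual_def)
  have "\<bar>f x\<bar> \<le> \<bar>C\<bar> * norm x" if "x \<in> X" for x
    using bspec[OF C that] mult_right_mono[OF abs_ge_self[of C] norm_ge_zero[of x]] by linarith
  then show ?thesis using that[of "\<bar>C\<bar>"] by simp
qed

lemma continuous_on_dual:
  assumes "f \<in> dual X" "subspace X"
  shows "continuous_on X f"
proof -
  obtain C where C: "C \<ge> 0" "\<And>x. x \<in> X \<Longrightarrow> \<bar>f x\<bar> \<le> C * norm x"
    using dual_bounded[OF assms(1)] by blast
  have lin: "linear_on X f" using assms(1) by (simp add: dual_def)
  have "C-lipschitz_on X f"
    using C assms(2)
    by (intro lipschitz_onI)
      (simp_all add: dist_norm linear_on_diff[OF assms(2) lin, symmetric] subspace_diff)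
  then show ?thesis by (rule lipschitz_on_continuous_on)
qed

lemma dual_eqI_dense:
  assumes "f \<in> dual X" "g \<in> dual X" "subspace V" "X = closure V" "\<And>v. v \<in> V \<Longrightarrow> f v = g v"
  shows "f = g"
proof
  fix x
  have X: "subspace X" using assms(3,4) subspace_closure by simp
  show "f x = g x"
  proof (cases "x \<in> X")
    case True
    have "continuous_on (closure V) (\<lambda>x. f x - g x)"
      using continuous_on_dual[OF assms(1) X] continuous_on_dual[OF assms(2) X] assms(4)
      by (auto intro: continuous_intros)
    from continuous_constant_on_closure[OF this, of 0 x] show ?thesis using True assms by auto
  next
    case False
    then show ?thesis using assms by (simp add: dual_def)
  qed
qed

text \<open>A functional dominated by the norm is 1-Lipschitz, hence uniformly continuous, and so
  extends continuously to the closure; linearity and the bound pass to limits.\<close>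

lemma dual_ball_extend:
  assumes V: "subspace V" and lin: "linear_on V \<phi>" and bd: "\<And>v. v \<in> V \<Longrightarrow> \<bar>\<phi> v\<bar> \<le> norm v"
  obtains f where "f \<in> dual_ball (closure V)" "\<And>v. v \<in> V \<Longrightarrow> f v = \<phi> v"
proof -
  have "1-lipschitz_on V \<phi>"
    using V bd by (intro lipschitz_onI)
      (simp_all add: dist_norm linear_on_diff[OF V lin, symmetric] subspace_diff)
  from lipschitz_on_uniformly_continuous[OF this]
  obtain g where g: "uniformly_continuous_on (closure V) g" "\<And>x. x \<in> V \<Longrightarrow> \<phi> x = g x"
    by (rule uniformly_continuous_on_extension_on_closure) blast
  have cont: "continuous_on (closure V) g" using g(1) by (rule uniformly_continuous_imp_continuous)
  have lim: "(\<lambda>n. g (s n)) \<longlonglongrightarrow> g x" if "s \<longlonglongrightarrow> x" "\<And>n. s n \<in> closure V" "x \<in> closure V" for s x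
    using continuous_on_tendsto_compose[OF cont that(1,3)] that(2) by simp
  have sub: "subspace (closure V)" using V by (rule subspace_closure)
  \<comment> \<open>The default value 0 off the closure is the one that \<open>dual\<close>
    prescribes.\<close>
  let ?f = "\<lambda>x. if x \<in> closure V then g x else 0"
  have lin': "linear_on (closure V) ?f"
    unfolding linear_on_def
  proof (intro conjI ballI allI)
    fix x y assume xy: "x \<in> closure V" "y \<in> closure V"
    then obtain s t where s: "\<And>n. s n \<in> V" "s \<longlonglongrightarrow> x" and t: "\<And>n. t n \<in> V" "t \<longlonglongrightarrow> y"
      by (metis closure_sequential)
    have "(\<lambda>n. g (s n + t n)) \<longlonglongrightarrow> g (x + y)"
      using s t xy V sub closure_subset[of V] by (intro lim tendsto_add) (auto simp: subspace_add)
    moreover have "g (s n + t n) = g (s n) + g (t n)" for n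
      using g(2) s(1) t(1) V lin by (metis linear_on_add subspace_add)
    moreover have "(\<lambda>n. g (s n) + g (t n)) \<longlonglongrightarrow> g x + g y"
      using s t xy closure_subset[of V] by (intro lim tendsto_add) auto
    ultimately show "?f (x + y) = ?f x + ?f y"
      using xy sub LIMSEQ_unique by (simp add: subspace_add)
  next
    fix c x assume x: "x \<in> closure V"
    then obtain s where s: "\<And>n. s n \<in> V" "s \<longlonglongrightarrow> x" by (metis closure_sequential)
    have "(\<lambda>n. g (c *\<^sub>R s n)) \<longlonglongrightarrow> g (c *\<^sub>R x)"
      using s x V sub closure_subset[of V] by (intro lim tendsto_scaleR) (auto simp: subspace_scale)
    moreover have "g (c *\<^sub>R s n) = c *\<^sub>R g (s n)" for n
      using g(2) s(1) V lin by (metis linear_on_scaleR subspace_scale)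
    moreover have "(\<lambda>n. c *\<^sub>R g (s n)) \<longlonglongrightarrow> c *\<^sub>R g x"
      using s x closure_subset[of V] by (intro lim tendsto_scaleR) auto
    ultimately show "?f (c *\<^sub>R x) = c *\<^sub>R ?f x"
      using x sub LIMSEQ_unique by (simp add: subspace_scale)
  qed
  \<comment> \<open>With the norm moved to the left, the bound is the constant 0, and a constant
    bound for a continuous function extends from \<open>V\<close> to its closure.\<close>
  have "\<bar>g x\<bar> - norm x \<le> 0" if "x \<in> closure V" for x
  proof (rule continuous_le_on_closure[OF _ that])
    show "continuous_on (closure V) (\<lambda>x. \<bar>g x\<bar> - norm x)"
      using cont by (intro continuous_intros)
    show "\<bar>g v\<bar> - norm v \<le> 0" if "v \<in> V" for v
      using bd[OF that] g(2)[OF that] by simp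
  qed
  then have "?f \<in> dual_ball (closure V)"
    using lin' by (intro dual_ballI) (simp_all add: algebra_simps)
  then show ?thesis
    using that[of ?f] g(2) subsetD[OF closure_subset, of _ V] by simp
qed

section \<open>Convex hulls of two compact convex sets of functions\<close>

text \<open>The variational inequality for a nearest point, where distance is Euclidean in the
  \<open>n\<close> coordinates \<open>v k\<close> only. It takes the place of a separation theorem:
  \<open>p\<close> maximises over \<open>H\<close> the linear form given by the residual of
  \<open>f\<close> at \<open>p\<close>.\<close>

lemma nearest_point_obtuse:
  fixes H :: "('a \<Rightarrow> real) set" and v :: "nat \<Rightarrow> 'a"
  assumes "compact H" "convex H" "H \<noteq> {}"
  obtains p where "p \<in> H"
    "\<And>h. h \<in> H \<Longrightarrow> (\<Sum>k<n. (f (v k) - p (v k)) * h (v k)) \<le> (\<Sum>k<n. (f (v k) - p (v k)) * p (v k))"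
proof -
  have sq: "(a - ((1 - t) * b + t * c))\<^sup>2 = (a - b)\<^sup>2 - 2 * t * ((a - b) * (c - b)) + t\<^sup>2 * (c - b)\<^sup>2"
    for a b c t :: real by (simp add: power2_eq_square algebra_simps)
  let ?q = "\<lambda>g. \<Sum>k<n. (f (v k) - g (v k))\<^sup>2"
  have "continuous_on H ?q"
    by (intro continuous_on_sum continuous_on_power continuous_on_diff continuous_on_const
        continuous_on_eval)
  then obtain p where p: "p \<in> H" "\<And>h. h \<in> H \<Longrightarrow> ?q p \<le> ?q h"
    using continuous_attains_inf[OF assms(1,3)] by blast
  have "(\<Sum>k<n. (f (v k) - p (v k)) * (h (v k) - p (v k))) \<le> 0" if h: "h \<in> H" for h
  proof (rule ccontr)
    define S where "S = (\<Sum>k<n. (f (v k) - p (v k)) * (h (v k) - p (v k)))"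
    define Q where "Q = (\<Sum>k<n. (h (v k) - p (v k))\<^sup>2)"
    assume "\<not> (\<Sum>k<n. (f (v k) - p (v k)) * (h (v k) - p (v k))) \<le> 0"
    then have S: "S > 0" by (simp add: S_def)
    have Q: "Q \<ge> 0" by (simp add: Q_def sum_nonneg)
    \<comment> \<open>Moving from \<open>p\<close> towards \<open>h\<close> by \<open>t\<close>
      changes the squared distance by \<open>- 2 * t * S + t\<^sup>2 * Q\<close>, which minimality
      makes nonnegative.\<close>
    have ineq: "2 * S \<le> t * Q" if t: "0 < t" "t \<le> 1" for t
    proof -
      have "(1 - t) *\<^sub>R p + t *\<^sub>R h \<in> H"
        using assms(2) p(1) h t by (simp add: convex_alt)
      then have "?q p \<le> ?q ((1 - t) *\<^sub>R p + t *\<^sub>R h)" by (rule p(2))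
      also have "\<dots> = (\<Sum>k<n. (f (v k) - p (v k))\<^sup>2
          - 2 * t * ((f (v k) - p (v k)) * (h (v k) - p (v k))) + t\<^sup>2 * (h (v k) - p (v k))\<^sup>2)"
        by (simp only: plus_fun_apply scaleR_fun_apply real_scaleR_def sq)
      also have "\<dots> = ?q p - 2 * t * S + t\<^sup>2 * Q"
        by (simp only: S_def Q_def sum.distrib sum_subtractf sum_distrib_left)
      finally have "2 * t * S \<le> t\<^sup>2 * Q" by linarith
      then have "t * (2 * S) \<le> t * (t * Q)" by (simp add: power2_eq_square ac_simps)
      with t show ?thesis by (simp only: mult_le_cancel_left_pos)
    qed
    \<comment> \<open>This \<open>t\<close> is small enough for \<open>t * Q < S\<close>, against
      \<open>2 * S \<le> t * Q\<close>; adding 1 to \<open>Q\<close> keeps the quotient meaningful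
      when \<open>Q = 0\<close>.\<close>
    have "2 * S \<le> min 1 (S / (Q + 1)) * Q" using S Q by (intro ineq) auto
    moreover have "min 1 (S / (Q + 1)) * Q \<le> S / (Q + 1) * Q"
      using Q by (intro mult_right_mono) auto
    moreover have "S / (Q + 1) * Q < S * 1"
      using S Q by (simp add: pos_divide_less_eq)
    ultimately show False using S by linarith
  qed
  then have "(\<Sum>k<n. (f (v k) - p (v k)) * h (v k)) \<le> (\<Sum>k<n. (f (v k) - p (v k)) * p (v k))"
    if "h \<in> H" for h
    using that by (simp add: right_diff_distrib sum_subtractf)
  with p(1) show ?thesis by (rule that)
qed

text \<open>The set is the image of the compact product of \<open>{0..1}\<close>, \<open>S\<close>
  and \<open>T\<close>. Functions carry the product topology, so continuity of the combination map
  is checked coordinate by coordinate.\<close>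

lemma compact_convex_combinations_fun:
  fixes S T :: "('a \<Rightarrow> real) set"
  assumes "compact S" "compact T"
  shows "compact {(1 - u) *\<^sub>R x + u *\<^sub>R y |u x y. 0 \<le> u \<and> u \<le> 1 \<and> x \<in> S \<and> y \<in> T}"
proof -
  have eq: "{(1 - u) *\<^sub>R x + u *\<^sub>R y |u x y. 0 \<le> u \<and> u \<le> 1 \<and> x \<in> S \<and> y \<in> T} =
      (\<lambda>z. (1 - fst z) *\<^sub>R fst (snd z) + fst z *\<^sub>R snd (snd z)) ` ({0..1} \<times> S \<times> T)"
    (is "?L = ?R")
  proof (intro equalityI subsetI)
    fix z assume "z \<in> ?L"
    then obtain u x y where "z = (1 - u) *\<^sub>R x + u *\<^sub>R y" "0 \<le> u" "u \<le> 1" "x \<in> S" "y \<in> T"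
      by blast
    then show "z \<in> ?R" by (intro image_eqI[of _ _ "(u, x, y)"]) auto
  next
    fix z assume "z \<in> ?R"
    then obtain u x y where "z = (1 - u) *\<^sub>R x + u *\<^sub>R y" "0 \<le> u" "u \<le> 1" "x \<in> S" "y \<in> T"
      by auto
    then show "z \<in> ?L" by blast
  qed
  have cont: "continuous_on ({0..1} \<times> S \<times> T)
      (\<lambda>z. (1 - fst z) *\<^sub>R fst (snd z) + fst z *\<^sub>R snd (snd z))"
  proof (rule continuous_on_coordinatewise_then_product)
    fix i
    have fs: "continuous_on ({0..1} \<times> S \<times> T) (\<lambda>z :: real \<times> ('a \<Rightarrow> real) \<times> ('a \<Rightarrow> real). fst (snd z) i)"
      by (rule continuous_on_product_then_coordinatewise[OF
            continuous_on_fst[OF continuous_on_snd[OF continuous_on_id]]])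
    have sn: "continuous_on ({0..1} \<times> S \<times> T) (\<lambda>z :: real \<times> ('a \<Rightarrow> real) \<times> ('a \<Rightarrow> real). snd (snd z) i)"
      by (rule continuous_on_product_then_coordinatewise[OF
            continuous_on_snd[OF continuous_on_snd[OF continuous_on_id]]])
    show "continuous_on ({0..1} \<times> S \<times> T)
        (\<lambda>z. ((1 - fst z) *\<^sub>R fst (snd z) + fst z *\<^sub>R snd (snd z)) i)"
      unfolding plus_fun_apply scaleR_fun_apply
      by (intro continuous_on_add continuous_on_scaleR continuous_on_diff continuous_on_const
          continuous_on_fst continuous_on_id fs sn)
  qed
  show ?thesis
    unfolding eq
    by (rule compact_continuous_image[OF cont compact_Times[OF compact_Icc compact_Times[OF assms]]])
qed

text \<open>In a convex combination of two such points, the two terms from \<open>S\<close> are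
  merged into one multiple of a point of \<open>S\<close>, and likewise for \<open>T\<close>; the
  merged weights again add up to 1.\<close>

lemma convex_convex_combinations:
  fixes S T :: "'a::real_vector set"
  assumes "convex S" "convex T"
  shows "convex {(1 - u) *\<^sub>R x + u *\<^sub>R y |u x y. 0 \<le> u \<and> u \<le> 1 \<and> x \<in> S \<and> y \<in> T}"
proof -
  \<comment> \<open>Merging divides by the total weight; if that is 0, any point of \<open>C\<close>
    serves.\<close>
  have comb: "\<exists>z\<in>C. a *\<^sub>R x + b *\<^sub>R y = (a + b) *\<^sub>R z"
    if "convex C" "x \<in> C" "y \<in> C" "a \<ge> 0" "b \<ge> 0" for C :: "'a set" and x y and a b :: real
  proof (cases "a + b = 0")
    case True
    with that have "a = 0" "b = 0" by auto
    with that show ?thesis by auto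
  next
    case False
    have "(a / (a + b)) *\<^sub>R x + (b / (a + b)) *\<^sub>R y \<in> C"
      using that False by (intro convexD) (auto simp: add_divide_distrib[symmetric])
    moreover have "a *\<^sub>R x + b *\<^sub>R y = (a + b) *\<^sub>R ((a / (a + b)) *\<^sub>R x + (b / (a + b)) *\<^sub>R y)"
      using False by (simp add: scaleR_add_right)
    ultimately show ?thesis by blast
  qed
  show ?thesis
    unfolding convex_def
  proof (clarsimp)
    fix a b u v :: real and x y x' y'
    assume ab: "0 \<le> a" "0 \<le> b" "a + b = 1" and u: "0 \<le> u" "u \<le> 1" and v: "0 \<le> v" "v \<le> 1"
      and S: "x \<in> S" "x' \<in> S" and T: "y \<in> T" "y' \<in> T"
    have "0 \<le> a * (1 - u)" "0 \<le> b * (1 - v)" using ab u v by auto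
    from comb[OF assms(1) S this] obtain s where s: "s \<in> S"
      "(a * (1 - u)) *\<^sub>R x + (b * (1 - v)) *\<^sub>R x' = (a * (1 - u) + b * (1 - v)) *\<^sub>R s"
      by blast
    have "0 \<le> a * u" "0 \<le> b * v" using ab u v by auto
    from comb[OF assms(2) T this] obtain t where t: "t \<in> T"
      "(a * u) *\<^sub>R y + (b * v) *\<^sub>R y' = (a * u + b * v) *\<^sub>R t"
      by blast
    have w: "a * (1 - u) + b * (1 - v) = 1 - (a * u + b * v)" using ab by (simp add: algebra_simps)
    have "a *\<^sub>R ((1 - u) *\<^sub>R x + u *\<^sub>R y) + b *\<^sub>R ((1 - v) *\<^sub>R x' + v *\<^sub>R y') =
        ((a * (1 - u)) *\<^sub>R x + (b * (1 - v)) *\<^sub>R x') + ((a * u) *\<^sub>R y + (b * v) *\<^sub>R y')"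
      by (simp add: scaleR_add_right)
    also have "\<dots> = (1 - (a * u + b * v)) *\<^sub>R s + (a * u + b * v) *\<^sub>R t"
      by (simp only: s(2) t(2) w)
    finally have "a *\<^sub>R ((1 - u) *\<^sub>R x + u *\<^sub>R y) + b *\<^sub>R ((1 - v) *\<^sub>R x' + v *\<^sub>R y') =
        (1 - (a * u + b * v)) *\<^sub>R s + (a * u + b * v) *\<^sub>R t" .
    moreover have "a * u + b * v \<le> 1" using u v ab by (simp add: convex_bound_le)
    moreover have "0 \<le> a * u + b * v" using u v ab by simp
    ultimately show "\<exists>w xa ya. a *\<^sub>R ((1 - u) *\<^sub>R x + u *\<^sub>R y) + b *\<^sub>R ((1 - v) *\<^sub>R x' + v *\<^sub>R y') =
        (1 - w) *\<^sub>R xa + w *\<^sub>R ya \<and> 0 \<le> w \<and> w \<le> 1 \<and> xa \<in> S \<and> ya \<in> T"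
      using s(1) t(1) by (intro exI conjI)
  qed
qed

section \<open>Functionals on the space of an adequate family\<close>

lemma sum_fun_apply: "(\<Sum>i\<in>S. g i) x = (\<Sum>i\<in>S. g i x)" for g :: "'i \<Rightarrow> 'a \<Rightarrow> 'b::comm_monoid_add"
  by (induction S rule: infinite_finite_induct) auto

lemma c00_finite: "finite S \<Longrightarrow> (\<And>i. i \<notin> S \<Longrightarrow> a i = 0) \<Longrightarrow> a \<in> c00"
  unfolding c00_def using finite_subset[of "{i. a i \<noteq> 0}" S] by auto

lemma subspace_c00: "subspace c00"
  unfolding subspace_def
proof (intro conjI ballI allI)
  show "0 \<in> c00" by (simp add: c00_def)
  show "a + b \<in> c00" if "a \<in> c00" "b \<in> c00" for a b
    using that by (intro c00_finite[of "{i. a i \<noteq> 0} \<union> {i. b i \<noteq> 0}"]) (auto simp: c00_def)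
  show "c *\<^sub>R a \<in> c00" if "a \<in> c00" for a c
    using that by (intro c00_finite[of "{i. a i \<noteq> 0}"]) (auto simp: c00_def)
qed

definition unit_seq :: "nat \<Rightarrow> nat \<Rightarrow> real" where
  "unit_seq i = (\<lambda>k. of_bool (k = i))"

lemma unit_seq_in_c00: "unit_seq i \<in> c00"
  by (rule c00_finite[of "{i}"]) (auto simp: unit_seq_def)

lemma c00_expansion:
  assumes "finite S" "\<And>i. i \<notin> S \<Longrightarrow> a i = 0"
  shows "a = (\<Sum>i\<in>S. a i *\<^sub>R unit_seq i)"
proof
  fix k
  have "(\<Sum>i\<in>S. a i * of_bool (k = i)) = (\<Sum>i\<in>S. if i = k then a i else 0)"
    by (intro sum.cong) auto
  then show "a k = (\<Sum>i\<in>S. a i *\<^sub>R unit_seq i) k"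
    using assms by (simp add: sum_fun_apply unit_seq_def)
qed

locale h1_space =
  fixes \<A> :: "nat set set" and j :: "(nat \<Rightarrow> real) \<Rightarrow> 'v::real_normed_vector" and X :: "'v set"
  assumes adequate: "adequate \<A>" and finite_sets: "A \<in> \<A> \<Longrightarrow> finite A" and is_h1: "is_h1 \<A> j X"
begin

abbreviation b :: "nat \<Rightarrow> 'v" where
  "b i \<equiv> j (unit_seq i)"

lemma empty_mem: "{} \<in> \<A>"
  and singleton_mem: "{i} \<in> \<A>"
  using adequate by (simp_all add: adequate_def)

lemma hereditary: "A \<in> \<A> \<Longrightarrow> B \<subseteq> A \<Longrightarrow> B \<in> \<A>"
  using adequate unfolding adequate_def by (elim conjE) (drule (1) bspec, iprover)

lemma compact_family: "(\<And>F. F \<subseteq> A \<Longrightarrow> finite F \<Longrightarrow> F \<in> \<A>) \<Longrightarrow> A \<in> \<A>"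
  using adequate unfolding adequate_def by (elim conjE) (drule spec[of _ A], iprover)

lemma linear_j: "linear_on c00 j"
  and norm_j: "a \<in> c00 \<Longrightarrow> norm (j a) = h1_norm \<A> a"
  and X_eq: "X = closure (j ` c00)"
  using is_h1 unfolding is_h1_def is_completion_def by auto

lemma subspace_range_j: "subspace (j ` c00)"
  by (rule subspace_linear_on_image[OF subspace_c00 linear_j])

lemma j_in_X: "a \<in> c00 \<Longrightarrow> j a \<in> X"
  unfolding X_eq by (rule subsetD[OF closure_subset imageI])

lemma b_in_X: "b i \<in> X"
  by (rule j_in_X[OF unit_seq_in_c00])

lemma h1_norm_le:
  assumes "\<And>A. A \<in> \<A> \<Longrightarrow> (\<Sum>i\<in>{i\<in>A. a i \<noteq> 0}. \<bar>a i\<bar>) \<le> C"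
  shows "h1_norm \<A> a \<le> C"
  unfolding h1_norm_def
proof (rule cSUP_least)
  show "\<A> \<noteq> {}" using empty_mem by (rule ex_in_conv[THEN iffD1, OF exI])
qed (rule assms)

lemma norm_b: "norm (b i) = 1"
proof -
  have "h1_norm \<A> (unit_seq i) = 1"
  proof (rule antisym)
    show "h1_norm \<A> (unit_seq i) \<le> 1"
    proof (rule h1_norm_le)
      fix A
      have "{k \<in> A. unit_seq i k \<noteq> 0} \<subseteq> {i}" by (auto simp: unit_seq_def)
      then have "(\<Sum>k\<in>{k \<in> A. unit_seq i k \<noteq> 0}. \<bar>unit_seq i k\<bar>) \<le> (\<Sum>k\<in>{i}. \<bar>unit_seq i k\<bar>)"
        by (intro sum_mono2) auto
      then show "(\<Sum>k\<in>{k \<in> A. unit_seq i k \<noteq> 0}. \<bar>unit_seq i k\<bar>) \<le> 1"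
        by (simp add: unit_seq_def)
    qed
    have "{k \<in> {i}. unit_seq i k \<noteq> 0} = {i}" by (auto simp: unit_seq_def)
    then show "1 \<le> h1_norm \<A> (unit_seq i)"
      using h1_sum_le_norm[OF unit_seq_in_c00 singleton_mem[of i], of i] by (simp add: unit_seq_def)
  qed
  then show ?thesis by (simp add: norm_j unit_seq_in_c00)
qed

lemma apply_j:
  assumes lin: "linear_on X f" and S: "finite S" "\<And>i. i \<notin> S \<Longrightarrow> a i = 0"
  shows "f (j a) = (\<Sum>i\<in>S. a i * f (b i))"
proof -
  have fj: "linear_on c00 (\<lambda>a. f (j a))"
    unfolding linear_on_def
    by (simp add: linear_on_add[OF linear_j] linear_on_scaleR[OF linear_j]
        linear_on_add[OF lin] linear_on_scaleR[OF lin, unfolded real_scaleR_def] j_in_X)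
  have "f (j a) = f (j (\<Sum>i\<in>S. a i *\<^sub>R unit_seq i))"
    by (rule arg_cong[OF c00_expansion[of S a, OF S], of "\<lambda>a. f (j a)"])
  also have "\<dots> = (\<Sum>i\<in>S. f (j (a i *\<^sub>R unit_seq i)))"
    by (rule linear_on_sum[OF subspace_c00 fj]) (simp add: subspace_scale[OF subspace_c00] unit_seq_in_c00)
  also have "\<dots> = (\<Sum>i\<in>S. a i * f (b i))"
    by (intro sum.cong refl) (simp add: linear_on_scaleR[OF fj] unit_seq_in_c00)
  finally show ?thesis .
qed

lemma dual_eqI:
  assumes f: "f \<in> dual X" and g: "g \<in> dual X" and "\<And>i. f (b i) = g (b i)"
  shows "f = g"
proof (rule dual_eqI_dense[OF f g subspace_range_j X_eq])
  fix v assume "v \<in> j ` c00"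
  then obtain a where a: "a \<in> c00" "v = j a" by blast
  have lin: "linear_on X f" "linear_on X g" using f g by (auto simp: dual_def)
  have fin: "finite {i. a i \<noteq> 0}" using a by (simp add: c00_def)
  have "f (j a) = (\<Sum>i | a i \<noteq> 0. a i * f (b i))" by (rule apply_j[OF lin(1) fin]) simp
  also have "\<dots> = (\<Sum>i | a i \<noteq> 0. a i * g (b i))" by (simp only: assms(3))
  also have "\<dots> = g (j a)" by (rule apply_j[OF lin(2) fin, symmetric]) simp
  finally show "f v = g v" using a by simp
qed

lemma dual_ball_coeff_le: "f \<in> dual_ball X \<Longrightarrow> \<bar>f (b i)\<bar> \<le> 1"
  using dual_ball_abs_le[of f X "b i"] by (simp add: norm_b)

text \<open>The form summing \<open>\<epsilon> i * a i\<close> over \<open>A\<close> is at most the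
  sum of the \<open>\<bar>a i\<bar>\<close> over \<open>A\<close>, one of the sums whose supremum is
  the norm. It therefore descends to the range of \<open>j\<close> and extends to
  \<open>X\<close>.\<close>

lemma signed_indicator_exists:
  assumes A: "A \<in> \<A>" and \<epsilon>: "\<And>i. \<bar>\<epsilon> i\<bar> \<le> 1"
  obtains f where "f \<in> dual_ball X" "\<And>k. f (b k) = (if k \<in> A then \<epsilon> k else 0)"
proof -
  define \<psi> where "\<psi> a = (\<Sum>i\<in>A. \<epsilon> i * a i)" for a
  have finA: "finite A" using A by (rule finite_sets)
  have \<psi>_lin: "linear_on UNIV \<psi>"
    by (simp add: linear_on_def \<psi>_def algebra_simps sum.distrib sum_distrib_left)
  have \<psi>_le: "\<bar>\<psi> a\<bar> \<le> norm (j a)" if a: "a \<in> c00" for a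
  proof -
    have "\<bar>\<psi> a\<bar> \<le> (\<Sum>i\<in>A. \<bar>a i\<bar>)"
      unfolding \<psi>_def using \<epsilon>
      by (intro order_trans[OF sum_abs] sum_mono) (simp add: abs_mult mult_left_le_one_le)
    also have "\<dots> = (\<Sum>i\<in>{i\<in>A. a i \<noteq> 0}. \<bar>a i\<bar>)"
      using finA by (intro sum.mono_neutral_right) auto
    also have "\<dots> \<le> norm (j a)" using h1_sum_le_norm[OF a A] a by (simp add: norm_j)
    finally show ?thesis .
  qed
  \<comment> \<open>\<open>inv_into\<close> picks some preimage. Two preimages differ by a vector
    that \<open>j\<close> sends to 0, where \<open>\<psi>_le\<close> forces \<open>\<psi>\<close> to
    vanish, so the choice is immaterial.\<close>
  define \<phi> where "\<phi> v = \<psi> (inv_into c00 j v)" for v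
  have \<phi>_j: "\<phi> (j a) = \<psi> a" if a: "a \<in> c00" for a
  proof -
    let ?c = "inv_into c00 j (j a)"
    have c: "?c \<in> c00" "j ?c = j a" 
      using a by (auto intro!: inv_into_into simp: f_inv_into_f[OF imageI])
    have "\<bar>\<psi> (?c - a)\<bar> \<le> norm (j (?c - a))"
      using a c by (intro \<psi>_le subspace_diff[OF subspace_c00])
    also have "\<dots> = 0" using linear_on_diff[OF subspace_c00 linear_j c(1) a] c(2) by simp
    finally show ?thesis
      using linear_on_diff[OF subspace_UNIV \<psi>_lin, of ?c a] by (simp add: \<phi>_def)
  qed
  have "linear_on (j ` c00) \<phi>"
    unfolding linear_on_def
    by (auto simp: linear_on_add[OF linear_j, symmetric] linear_on_scaleR[OF linear_j, symmetric]
        \<phi>_j subspace_add[OF subspace_c00] subspace_scale[OF subspace_c00]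
        linear_on_add[OF \<psi>_lin] linear_on_scaleR[OF \<psi>_lin, unfolded real_scaleR_def])
  moreover have "\<bar>\<phi> v\<bar> \<le> norm v" if "v \<in> j ` c00" for v
    using that by (auto simp: \<phi>_j \<psi>_le)
  ultimately obtain f where f: "f \<in> dual_ball X" "\<And>v. v \<in> j ` c00 \<Longrightarrow> f v = \<phi> v"
    using dual_ball_extend[OF subspace_range_j, of \<phi>] unfolding X_eq by blast
  have "f (b k) = (if k \<in> A then \<epsilon> k else 0)" for k
  proof -
    have "f (b k) = \<psi> (unit_seq k)" using f(2) \<phi>_j unit_seq_in_c00 by simp
    also have "\<dots> = (\<Sum>i\<in>A. if i = k then \<epsilon> i else 0)"
      unfolding \<psi>_def unit_seq_def by (intro sum.cong) auto
    also have "\<dots> = (if k \<in> A then \<epsilon> k else 0)" using finA by simp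
    finally show ?thesis .
  qed
  with f(1) show ?thesis by (rule that)
qed

section \<open>Extreme points of the dual ball\<close>

text \<open>The pieces \<open>s f(b\<^sub>i) = 1\<close> and \<open>s f(b\<^sub>i) \<le> 0\<close> contain all signed indicators of members of
  \<open>\<A>\<close>, which norm \<open>c\<^sub>0\<^sub>0\<close>; hence the nearest point of their joint convex hull to a functional in
  the dual ball agrees with it on any finitely many coordinates.\<close>

lemma dual_ball_split:
  assumes f: "f \<in> dual_ball X" and s: "s = 1 \<or> s = -1"
  obtains u g h where "0 \<le> u" "u \<le> 1" "g \<in> dual_ball X" "h \<in> dual_ball X"
    "s * g (b i) \<le> 0" "s * h (b i) = 1" "f = (1 - u) *\<^sub>R g + u *\<^sub>R h"
proof -
  define G where "G = dual_ball X \<inter> {g. s * g (b i) \<le> 0}"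
  define K where "K = dual_ball X \<inter> {h. s * h (b i) = 1}"
  define H where "H = {(1 - u) *\<^sub>R g + u *\<^sub>R h |u g h. 0 \<le> u \<and> u \<le> 1 \<and> g \<in> G \<and> h \<in> K}"
  have "convex {g. s * g (b i) \<le> 0}"
    unfolding convex_alt
  proof (clarsimp)
    fix g h and u :: real
    assume "s * g (b i) \<le> 0" "s * h (b i) \<le> 0" "0 \<le> u" "u \<le> 1"
    then have "(1 - u) * (s * g (b i)) \<le> 0" "u * (s * h (b i)) \<le> 0"
      by (simp_all only: mult_nonneg_nonpos diff_ge_0_iff_ge)
    then have "(1 - u) * (s * g (b i)) + u * (s * h (b i)) \<le> 0" by (rule add_nonpos_nonpos)
    then show "s * ((1 - u) * g (b i) + u * h (b i)) \<le> 0" by (simp add: algebra_simps)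
  qed
  then have convG: "convex G" unfolding G_def by (intro convex_Int convex_dual_ball)
  have "convex {h. s * h (b i) = 1}"
    unfolding convex_alt
  proof (clarsimp)
    fix g h and u :: real
    assume "s * g (b i) = 1" "s * h (b i) = 1"
    then have "(1 - u) * (s * g (b i)) + u * (s * h (b i)) = 1" by simp
    then show "s * ((1 - u) * g (b i) + u * h (b i)) = 1" by (simp add: algebra_simps)
  qed
  then have convK: "convex K" unfolding K_def by (intro convex_Int convex_dual_ball)
  have "compact G" "compact K"
    unfolding G_def K_def
    by (intro compact_Int_closed compact_dual_ball closed_Collect_le closed_Collect_eq
        continuous_on_mult continuous_on_const continuous_on_eval)+
  then have compH: "compact H" unfolding H_def by (rule compact_convex_combinations_fun)
  have convH: "convex H" unfolding H_def by (rule convex_convex_combinations[OF convG convK])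
  \<comment> \<open>Weights 0 and 1 place \<open>G\<close> and \<open>K\<close> inside
    \<open>H\<close> once the other piece is nonempty. The witnesses are 0 for \<open>G\<close> and
    the indicator of \<open>{i}\<close> with sign \<open>s\<close> for \<open>K\<close>.\<close>
  have "0 \<in> G" by (auto simp: G_def linear_on_def intro: dual_ballI)
  have "\<bar>s\<bar> \<le> 1" using s by auto
  with singleton_mem[of i] obtain k
    where "k \<in> dual_ball X" "\<And>l. k (b l) = (if l \<in> {i} then s else 0)"
    using signed_indicator_exists[of "{i}" "\<lambda>_. s"] by blast
  then have "k \<in> K" using s by (auto simp: K_def)
  have GH: "G \<subseteq> H"
  proof
    fix g assume "g \<in> G"
    then show "g \<in> H" unfolding H_def using \<open>k \<in> K\<close>
      by (intro CollectI exI[of _ 0] exI[of _ g] exI[of _ k]) simp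
  qed
  have KH: "K \<subseteq> H"
  proof
    fix h assume "h \<in> K"
    then show "h \<in> H" unfolding H_def using \<open>0 \<in> G\<close>
      by (intro CollectI exI[of _ 1] exI[of _ 0] exI[of _ h]) simp
  qed
  have HX: "H \<subseteq> dual_ball X"
    unfolding H_def G_def K_def using convex_dual_ball[of X] by (auto simp: convex_alt)
  have approx: "\<exists>p\<in>H. \<forall>k<n. p (b k) = f (b k)" for n
  proof -
    have "H \<noteq> {}" using \<open>k \<in> K\<close> KH by blast
    then obtain p where p: "p \<in> H" and obtuse: "\<And>h. h \<in> H \<Longrightarrow>
        (\<Sum>k<n. (f (b k) - p (b k)) * h (b k)) \<le> (\<Sum>k<n. (f (b k) - p (b k)) * p (b k))"
      by (rule nearest_point_obtuse[OF compH convH, where f = f and v = b and n = n]) (rule that)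
    have pX: "p \<in> dual_ball X" using p HX by blast
    \<comment> \<open>The residual of \<open>f\<close> at \<open>p\<close> on the first
      \<open>n\<close> coordinates, read as a vector: evaluating a functional at \<open>j y\<close>
      gives exactly the linear form in \<open>obtuse\<close>.\<close>
    define y where "y = (\<lambda>k. if k < n then f (b k) - p (b k) else 0)"
    have y: "y \<in> c00" by (rule c00_finite[of "{..<n}"]) (auto simp: y_def)
    have eval: "g (j y) = (\<Sum>k<n. (f (b k) - p (b k)) * g (b k))" if "g \<in> dual_ball X" for g
      using apply_j[OF dual_ballD(2)[OF that], of "{..<n}" y] by (simp add: y_def)
    have "h1_norm \<A> y \<le> p (j y)"
    proof (rule h1_norm_le)
      fix A assume A: "A \<in> \<A>"
      have "\<bar>sgn (y k)\<bar> \<le> 1" for k by (simp add: sgn_if)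
      \<comment> \<open>With the signs of \<open>y\<close> on \<open>A\<close>, \<open>w\<close>
        attains the sum of \<open>\<bar>y k\<bar>\<close> over \<open>A\<close>. Its coordinates lie
        in {-1, 0, 1}, which puts it in \<open>G\<close> or in \<open>K\<close>.\<close>
      with A obtain w where w: "w \<in> dual_ball X" "\<And>k. w (b k) = (if k \<in> A then sgn (y k) else 0)"
        using signed_indicator_exists[of A "\<lambda>k. sgn (y k)"] by blast
      have "s * w (b i) \<le> 0 \<or> s * w (b i) = 1"
        using s by (auto simp: w(2) sgn_if)
      then have "w \<in> H" using GH KH w(1) by (auto simp: G_def K_def)
      have "(\<Sum>k\<in>{k\<in>A. y k \<noteq> 0}. \<bar>y k\<bar>) = (\<Sum>k\<in>{k\<in>A. y k \<noteq> 0}. y k * w (b k))"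
        by (intro sum.cong) (auto simp: w(2) abs_sgn)
      also have "\<dots> = (\<Sum>k<n. y k * w (b k))"
        by (intro sum.mono_neutral_left) (auto simp: w(2) y_def split: if_splits)
      also have "\<dots> = w (j y)" unfolding eval[OF w(1)] by (simp add: y_def)
      also have "\<dots> \<le> p (j y)"
        using obtuse[OF \<open>w \<in> H\<close>] by (simp only: eval[OF w(1)] eval[OF pX])
      finally show "(\<Sum>k\<in>{k\<in>A. y k \<noteq> 0}. \<bar>y k\<bar>) \<le> p (j y)" .
    qed
    moreover have "f (j y) \<le> h1_norm \<A> y"
      using dual_ball_abs_le[OF f, of "j y"] norm_j[OF y] by simp
    ultimately have "f (j y) - p (j y) \<le> 0" by simp
    \<comment> \<open>By the choice of \<open>y\<close>, this difference is the squared distance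
      between \<open>f\<close> and \<open>p\<close> on the first \<open>n\<close> coordinates, which
      is therefore 0.\<close>
    moreover have "f (j y) - p (j y) = (\<Sum>k<n. (f (b k) - p (b k))\<^sup>2)"
      by (simp only: eval[OF f] eval[OF pX] sum_subtractf[symmetric] power2_eq_square
          right_diff_distrib[symmetric])
    ultimately have "(\<Sum>k<n. (f (b k) - p (b k))\<^sup>2) = 0"
      by (intro antisym sum_nonneg) auto
    then have "\<forall>k<n. p (b k) = f (b k)"
      by (simp add: sum_nonneg_eq_0_iff)
    with p show ?thesis by blast
  qed
  \<comment> \<open>Agreement on every finite set of coordinates becomes agreement on all of them by
    compactness of \<open>H\<close>.\<close>
  have "H \<inter> (\<Inter>n. {p. \<forall>k\<in>{..<n}. p (b k) = f (b k)}) \<noteq> {}"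
  proof (rule compact_imp_fip_image[OF compH])
    show "closed {p. \<forall>k\<in>{..<n}. p (b k) = f (b k)}" for n
    proof -
      have "{p. \<forall>k\<in>{..<n}. p (b k) = f (b k)} = (\<Inter>k\<in>{..<n}. {p. p (b k) = f (b k)})" by auto
      moreover have "closed \<dots>"
        by (intro closed_INT ballI closed_Collect_eq continuous_on_const continuous_on_eval)
      ultimately show ?thesis by simp
    qed
    fix I :: "nat set" assume I: "finite I"
    \<comment> \<open>The conditions grow stronger with \<open>n\<close>, so the largest index
      suffices; inserting 0 covers empty \<open>I\<close>.\<close>
    obtain p where p: "p \<in> H" "\<forall>k<Max (insert 0 I). p (b k) = f (b k)" using approx by blast
    have "n \<le> Max (insert 0 I)" if "n \<in> I" for n using I that by simp
    then have "p (b k) = f (b k)" if "n \<in> I" "k < n" for n k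
      using p(2) that order_less_le_trans by blast
    then have "p \<in> H \<inter> (\<Inter>n\<in>I. {p. \<forall>k\<in>{..<n}. p (b k) = f (b k)})" using p(1) by simp
    then show "H \<inter> (\<Inter>n\<in>I. {p. \<forall>k\<in>{..<n}. p (b k) = f (b k)}) \<noteq> {}"
      by blast
  qed
  then obtain p where p: "p \<in> H" "\<And>n k. k < n \<Longrightarrow> p (b k) = f (b k)" by auto
  have "p \<in> dual_ball X" using p(1) HX by blast
  have "f = p"
    by (rule dual_eqI[OF dual_ballD(1)[OF f] dual_ballD(1)[OF \<open>p \<in> dual_ball X\<close>]])
      (rule p(2)[OF lessI, symmetric])
  then obtain u g h where "f = (1 - u) *\<^sub>R g + u *\<^sub>R h" "0 \<le> u" "u \<le> 1" "g \<in> G" "h \<in> K"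
    using p(1) unfolding H_def by blast
  then show ?thesis using that[of u g h] by (simp add: G_def K_def)
qed

text \<open>Extremality makes the splitting of \<open>dual_ball_split\<close> trivial, so
  \<open>f\<close> itself lies in one of the two pieces. Combining this for both signs leaves only
  three values.\<close>

lemma ext_dual_ball_coeff:
  assumes f: "f \<in> ext_dual_ball X"
  shows "f (b i) \<in> {-1, 0, 1}"
proof -
  have "s * f (b i) \<le> 0 \<or> s * f (b i) = 1" if s: "s = 1 \<or> s = -1" for s
  proof -
    have ext: "f \<in> dual_ball X" "\<And>g h. g \<in> dual_ball X \<Longrightarrow> h \<in> dual_ball X \<Longrightarrow> f \<notin> open_segment g h"
      using f by (auto simp: ext_dual_ball_def extreme_point_of_def)
    obtain u g h where u: "0 \<le> u" "u \<le> 1" and gh: "g \<in> dual_ball X" "h \<in> dual_ball X"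
      "s * g (b i) \<le> 0" "s * h (b i) = 1" "f = (1 - u) *\<^sub>R g + u *\<^sub>R h"
      using dual_ball_split[OF ext(1) s] by metis
    have "g \<noteq> h" using gh(3,4) by auto
    then have "\<not> (0 < u \<and> u < 1)"
      using ext(2)[OF gh(1,2)] gh(5) unfolding in_segment by blast
    then have "u = 0 \<or> u = 1" using u by linarith
    then show ?thesis using gh by auto
  qed
  from this[of 1] this[of "-1"] show ?thesis by auto
qed

text \<open>For finite \<open>F\<close> inside the support, the sign vector of \<open>f\<close> on
  \<open>F\<close> is mapped by \<open>f\<close> to \<open>card F\<close>, so its norm is at least
  that, and some member must contain all of \<open>F\<close>. Compactness of the family passes from
  finite subsets to the whole support.\<close>

lemma ext_dual_ball_support:
  assumes f: "f \<in> ext_dual_ball X"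
  shows "{i. f (b i) \<noteq> 0} \<in> \<A>"
proof (rule compact_family)
  fix F assume F: "F \<subseteq> {i. f (b i) \<noteq> 0}" "finite F"
  have fX: "f \<in> dual_ball X" using f by (auto simp: ext_dual_ball_def extreme_point_of_def)
  define a where "a = (\<lambda>i. if i \<in> F then f (b i) else 0)"
  have abs1: "\<bar>f (b i)\<bar> = 1" if "i \<in> F" for i
    using ext_dual_ball_coeff[OF f, of i] F(1) that by auto
  have a: "a \<in> c00" using F(2) by (rule c00_finite) (simp add: a_def)
  have sq: "a i * f (b i) = 1" if "i \<in> F" for i
    using ext_dual_ball_coeff[OF f, of i] F(1) that by (auto simp: a_def)
  have "real (card F) = (\<Sum>i\<in>F. a i * f (b i))" by (simp add: sq)
  also have "\<dots> = f (j a)"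
    using apply_j[OF dual_ballD(2)[OF fX] F(2), of a] by (simp add: a_def)
  also have "\<dots> \<le> h1_norm \<A> a"
    using dual_ball_abs_le[OF fX, of "j a"] norm_j[OF a] by simp
  finally have card_le: "real (card F) \<le> h1_norm \<A> a" .
  have "\<exists>A\<in>\<A>. F \<subseteq> A"
  proof (rule ccontr)
    assume none: "\<not> (\<exists>A\<in>\<A>. F \<subseteq> A)"
    \<comment> \<open>Every member misses at least one point of \<open>F\<close>. This uniform gap
      of 1 survives the supremum.\<close>
    have "h1_norm \<A> a \<le> real (card F) - 1"
    proof (rule h1_norm_le)
      fix A assume "A \<in> \<A>"
      with none have "A \<inter> F \<subset> F" by blast
      then have "card (A \<inter> F) < card F" using F(2) by (rule psubset_card_mono[rotated])
      moreover have "(\<Sum>i\<in>{i\<in>A. a i \<noteq> 0}. \<bar>a i\<bar>) = (\<Sum>i\<in>A \<inter> F. 1)"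
        using F(1) by (intro sum.cong) (auto simp: a_def abs1)
      ultimately show "(\<Sum>i\<in>{i\<in>A. a i \<noteq> 0}. \<bar>a i\<bar>) \<le> real (card F) - 1" by simp
    qed
    with card_le show False by simp
  qed
  then show "F \<in> \<A>" using hereditary by blast
qed

text \<open>Adding \<open>s\<close> at \<open>k\<close> to the indicator of \<open>A\<close> does
  not raise the norm above \<open>card A\<close>, because no member contains both \<open>A\<close>
  and \<open>k\<close>; but \<open>g\<close> takes the value \<open>card A + s * g (b k)\<close>
  there. Both signs together give 0.\<close>

lemma norming_face_support:
  assumes g: "g \<in> dual_ball X" and A: "A \<in> \<A>" and max: "\<And>B. B \<in> \<A> \<Longrightarrow> A \<subseteq> B \<Longrightarrow> B = A"
    and one: "\<And>i. i \<in> A \<Longrightarrow> g (b i) = 1" and k: "k \<notin> A"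
  shows "g (b k) = 0"
proof -
  have "s * g (b k) \<le> 0" if s: "s = 1 \<or> s = -1" for s :: real
  proof -
    define a where "a = (\<lambda>i. if i = k then s else of_bool (i \<in> A))"
    have finA: "finite A" using A by (rule finite_sets)
    have a: "a \<in> c00" using finA by (intro c00_finite[of "insert k A"]) (auto simp: a_def)
    have "g (j a) = (\<Sum>i\<in>insert k A. a i * g (b i))"
      using finA by (intro apply_j dual_ballD(2)[OF g]) (auto simp: a_def)
    also have "\<dots> = s * g (b k) + (\<Sum>i\<in>A. 1)"
    proof -
      have "(\<Sum>i\<in>A. a i * g (b i)) = (\<Sum>i\<in>A. 1)"
        using k by (intro sum.cong) (auto simp: a_def one)
      then show ?thesis using finA k by (simp add: a_def)
    qed
    finally have "g (j a) = s * g (b k) + card A" by simp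
    moreover have "g (j a) \<le> h1_norm \<A> a"
      using dual_ball_abs_le[OF g, of "j a"] norm_j[OF a] by simp
    moreover have "h1_norm \<A> a \<le> card A"
    proof (rule h1_norm_le)
      fix B assume B: "B \<in> \<A>"
      have "(\<Sum>i\<in>{i\<in>B. a i \<noteq> 0}. \<bar>a i\<bar>) = card {i\<in>B. a i \<noteq> 0}"
        using s by (subst card_eq_sum, subst of_nat_sum, intro sum.cong) (auto simp: a_def)
      also have "\<dots> \<le> card (insert k A \<inter> B)"
        using finA by (auto simp: a_def intro!: card_mono)
      also have "card (insert k A \<inter> B) \<le> card A"
      proof (cases "k \<in> B")
        case True
        \<comment> \<open>By maximality, a member containing \<open>k\<close> pays for it with at
          least one point of \<open>A\<close>.\<close>
        have "\<not> A \<subseteq> B" using max[OF B] True k by blast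
        then have "A \<inter> B \<subset> A" by blast
        then have "card (A \<inter> B) < card A" by (rule psubset_card_mono[OF finA])
        then show ?thesis using True finA k by simp
      next
        case False
        then show ?thesis using finA by (auto intro!: card_mono)
      qed
      finally show "(\<Sum>i\<in>{i\<in>B. a i \<noteq> 0}. \<bar>a i\<bar>) \<le> card A" by simp
    qed
    ultimately show ?thesis by simp
  qed
  from this[of 1] this[of "-1"] show ?thesis by simp
qed

text \<open>If \<open>f\<close> lies strictly between \<open>g\<close> and \<open>h\<close>, both
  equal 1 on \<open>A\<close>, where \<open>f\<close> has the largest value a coordinate can take.
  By \<open>norming_face_support\<close> both vanish off \<open>A\<close>, so they coincide.\<close>

lemma maximal_indicator_extreme:
  assumes f: "f \<in> dual_ball X" and A: "A \<in> \<A>" and max: "\<And>B. B \<in> \<A> \<Longrightarrow> A \<subseteq> B \<Longrightarrow> B = A"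
    and ind: "\<And>i. f (b i) = of_bool (i \<in> A)"
  shows "f \<in> ext_dual_ball X"
  unfolding ext_dual_ball_def extreme_point_of_def
proof (intro CollectI conjI ballI notI f)
  fix g h assume g: "g \<in> dual_ball X" and h: "h \<in> dual_ball X" and "f \<in> open_segment g h"
  then obtain u where ne: "g \<noteq> h" and u: "0 < u" "u < 1" and fu: "f = (1 - u) *\<^sub>R g + u *\<^sub>R h"
    unfolding in_segment by blast
  have one: "g (b i) = 1 \<and> h (b i) = 1" if "i \<in> A" for i
  proof -
    \<comment> \<open>A sum of two nonnegative defects that equals 0 forces both to vanish.\<close>
    have "(1 - u) * (1 - g (b i)) + u * (1 - h (b i)) = 0"
    proof -
      have "(1 - u) * g (b i) + u * h (b i) = 1" using ind[of i] that by (simp add: fu)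
      then show ?thesis by (simp add: algebra_simps)
    qed
    moreover have "0 \<le> (1 - u) * (1 - g (b i))" "0 \<le> u * (1 - h (b i))"
      using u dual_ball_coeff_le[OF g, of i] dual_ball_coeff_le[OF h, of i]
      by (auto intro!: mult_nonneg_nonneg)
    ultimately have "(1 - u) * (1 - g (b i)) = 0" "u * (1 - h (b i)) = 0" by linarith+
    then show ?thesis using u by simp
  qed
  have "g (b i) = h (b i)" for i
  proof (cases "i \<in> A")
    case True
    then show ?thesis using one by simp
  next
    case False
    have "g (b i) = 0" by (rule norming_face_support[OF g A max _ False]) (simp_all add: one)
    moreover have "h (b i) = 0" by (rule norming_face_support[OF h A max _ False]) (simp_all add: one)
    ultimately show ?thesis by simp
  qed
  then have "g = h" by (rule dual_eqI[OF dual_ballD(1)[OF g] dual_ballD(1)[OF h]])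
  with ne show False by simp
qed

section \<open>Limit points of the extreme points\<close>

text \<open>Zorn's lemma: a finite subset of the union of a chain lies in one of its members, so by
  compactness of the family the union is again a member.\<close>

lemma maximal_extension:
  assumes "A \<in> \<A>"
  obtains M where "M \<in> \<A>" "A \<subseteq> M" "\<And>B. B \<in> \<A> \<Longrightarrow> M \<subseteq> B \<Longrightarrow> B = M"
proof -
  have "\<exists>M\<in>{B\<in>\<A>. A \<subseteq> B}. \<forall>B\<in>{B\<in>\<A>. A \<subseteq> B}. M \<subseteq> B \<longrightarrow> B = M"
  proof (rule subset_Zorn_nonempty)
    show "{B\<in>\<A>. A \<subseteq> B} \<noteq> {}" using assms by blast
    fix C assume ne: "C \<noteq> {}" and C: "subset.chain {B\<in>\<A>. A \<subseteq> B} C"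
    have "\<Union>C \<in> \<A>"
    proof (rule compact_family)
      fix F assume "F \<subseteq> \<Union>C" "finite F"
      then obtain B where "B \<in> C" "F \<subseteq> B"
        using finite_subset_Union_chain[OF _ _ ne C] by metis
      then show "F \<in> \<A>" using C hereditary by (auto simp: subset.chain_def)
    qed
    moreover have "A \<subseteq> \<Union>C" using ne C by (fastforce simp: subset.chain_def)
    ultimately show "\<Union>C \<in> {B\<in>\<A>. A \<subseteq> B}" by simp
  qed
  then obtain M where "M \<in> \<A>" "A \<subseteq> M" "\<forall>B\<in>\<A>. A \<subseteq> B \<longrightarrow> M \<subseteq> B \<longrightarrow> B = M" by auto
  then show ?thesis by (intro that[of M]) auto
qed

text \<open>A nonzero limit point \<open>f\<close> has some \<open>f (b i) \<noteq> 0\<close>, and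
  then infinitely many extreme points are nonzero at \<open>b i\<close>. Their supports are members
  containing \<open>i\<close>, and finitely many finite supports carry only finitely many sign
  patterns.\<close>

lemma I_polyhedral_if_finite:
  assumes fin: "\<And>i. finite {A\<in>\<A>. i \<in> A}"
  shows "I_polyhedral X"
  unfolding I_polyhedral_def
proof (rule subsetI, rule ccontr)
  fix f assume f: "f \<in> weak_star X derived_set_of ext_dual_ball X" and "f \<notin> {0}"
  have fX: "f \<in> dual X" using f by (simp add: in_derived_set_of topspace_weak_star)
  obtain i where i: "f (b i) \<noteq> 0"
  proof -
    have "(0 :: 'v \<Rightarrow> real) \<in> dual X"
      by (auto simp: dual_def linear_on_def intro: exI[of _ 0])
    from dual_eqI[OF fX this] \<open>f \<notin> {0}\<close> that show ?thesis by auto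
  qed
  define U where "U = {g \<in> dual X. g (b i) \<in> - {0}}"
  have "openin (weak_star X) U"
    unfolding U_def by (rule openin_weak_star_eval) (simp add: open_Compl)
  moreover have "f \<in> U" using fX i by (simp add: U_def)
  ultimately have inf: "infinite (ext_dual_ball X \<inter> U)"
    using f by (simp add: derived_set_of_infinite_openin[OF Hausdorff_space_weak_star])
  \<comment> \<open>As the coordinates of extreme points lie in {-1, 0, 1}, these two sets record
    all of them.\<close>
  define supports where "supports g = ({k. g (b k) = 1}, {k. g (b k) = -1})" for g :: "'v \<Rightarrow> real"
  have sub: "supports ` (ext_dual_ball X \<inter> U) \<subseteq>
      (\<Union>A\<in>{A\<in>\<A>. i \<in> A}. Pow A) \<times> (\<Union>A\<in>{A\<in>\<A>. i \<in> A}. Pow A)"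
  proof (rule image_subsetI)
    fix g assume g: "g \<in> ext_dual_ball X \<inter> U"
    let ?A = "{k. g (b k) \<noteq> 0}"
    have "?A \<in> {A\<in>\<A>. i \<in> A}" using g ext_dual_ball_support[of g] by (auto simp: U_def)
    moreover have "{k. g (b k) = 1} \<in> Pow ?A" "{k. g (b k) = -1} \<in> Pow ?A" by auto
    ultimately show "supports g \<in> (\<Union>A\<in>{A\<in>\<A>. i \<in> A}. Pow A) \<times> (\<Union>A\<in>{A\<in>\<A>. i \<in> A}. Pow A)"
      unfolding supports_def by blast
  qed
  have "inj_on supports (ext_dual_ball X \<inter> U)"
  proof (rule inj_onI)
    fix g h assume g: "g \<in> ext_dual_ball X \<inter> U" and h: "h \<in> ext_dual_ball X \<inter> U"
      and eq: "supports g = supports h"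
    show "g = h"
    proof (rule dual_eqI)
      show "g \<in> dual X" "h \<in> dual X" using g h by (auto simp: U_def)
      fix k
      have "g (b k) = 1 \<longleftrightarrow> h (b k) = 1" "g (b k) = -1 \<longleftrightarrow> h (b k) = -1"
        using eq by (auto simp: supports_def set_eq_iff)
      then show "g (b k) = h (b k)"
        using ext_dual_ball_coeff[of g k] ext_dual_ball_coeff[of h k] g h by auto
    qed
  qed
  moreover have "finite (supports ` (ext_dual_ball X \<inter> U))"
    by (rule finite_subset[OF sub]) (use fin finite_sets in auto)
  ultimately have "finite (ext_dual_ball X \<inter> U)" by (rule finite_imageD[rotated])
  with inf show False by simp
qed

text \<open>Otherwise the indicators of maximal members through \<open>i\<close> form an infinite
  set of extreme points. By weak* compactness it has a limit point, whose value at the unit vector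
  \<open>b i\<close> cannot drop below 1.\<close>

lemma finite_if_IV_polyhedral:
  assumes IV: "IV_polyhedral X"
  shows "finite {A\<in>\<A>. i \<in> A}"
proof (rule ccontr)
  assume inf: "infinite {A\<in>\<A>. i \<in> A}"
  define \<M> where "\<M> = {M\<in>\<A>. i \<in> M \<and> (\<forall>B\<in>\<A>. M \<subseteq> B \<longrightarrow> B = M)}"
  \<comment> \<open>Each maximal member is finite and has finitely many subsets, so infinitely many
    members through \<open>i\<close> need infinitely many maximal ones.\<close>
  have "{A\<in>\<A>. i \<in> A} \<subseteq> (\<Union>M\<in>\<M>. Pow M)"
  proof
    fix A assume A: "A \<in> {A\<in>\<A>. i \<in> A}"
    then obtain M where "M \<in> \<A>" "A \<subseteq> M" "\<And>B. B \<in> \<A> \<Longrightarrow> M \<subseteq> B \<Longrightarrow> B = M"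
      using maximal_extension by blast
    then have "M \<in> \<M>" "A \<in> Pow M" using A by (auto simp: \<M>_def)
    then show "A \<in> (\<Union>M\<in>\<M>. Pow M)" by blast
  qed
  then have "infinite (\<Union>M\<in>\<M>. Pow M)" using inf infinite_super by blast
  then have inf\<M>: "infinite \<M>" using finite_sets by (auto simp: \<M>_def)
  have "\<exists>f. f \<in> dual_ball X \<and> (\<forall>k. f (b k) = of_bool (k \<in> M))" if "M \<in> \<M>" for M
  proof -
    have "M \<in> \<A>" using that by (simp add: \<M>_def)
    then obtain f where "f \<in> dual_ball X" "\<And>k. f (b k) = (if k \<in> M then 1 else 0)"
      using signed_indicator_exists[of M "\<lambda>_. 1"] by auto
    then show ?thesis by (intro exI[of _ f]) simp
  qed
  then obtain F where F: "\<And>M. M \<in> \<M> \<Longrightarrow> F M \<in> dual_ball X"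
    "\<And>M k. M \<in> \<M> \<Longrightarrow> F M (b k) = of_bool (k \<in> M)" by metis
  have "inj_on F \<M>"
  proof (rule inj_onI)
    fix M N assume MN: "M \<in> \<M>" "N \<in> \<M>" "F M = F N"
    have "k \<in> M \<longleftrightarrow> k \<in> N" for k
      using F(2)[OF MN(1), of k] F(2)[OF MN(2), of k] MN(3) by (auto split: if_splits)
    then show "M = N" by blast
  qed
  with inf\<M> have "infinite (F ` \<M>)" using finite_imageD by blast
  then obtain f where f: "f \<in> weak_star X derived_set_of (F ` \<M>)"
    using compactin_imp_Bolzano_Weierstrass[OF compactin_weak_star_dual_ball, of "F ` \<M>"] F(1)
    by blast
  have "F ` \<M> \<subseteq> ext_dual_ball X"
    using F maximal_indicator_extreme by (auto simp: \<M>_def)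
  with f have "f \<in> weak_star X derived_set_of ext_dual_ball X"
    using derived_set_of_mono by blast
  moreover have "b i \<in> X \<inter> sphere 0 1" by (simp add: b_in_X norm_b)
  ultimately have "f (b i) < 1" using IV by (simp add: IV_polyhedral_def)
  \<comment> \<open>A neighbourhood of \<open>f\<close> that contains none of the indicators, since
    all of them take the value 1 at \<open>b i\<close>.\<close>
  define U where "U = {g \<in> dual X. g (b i) \<in> {..<1}}"
  have "openin (weak_star X) U" unfolding U_def by (rule openin_weak_star_eval) simp
  moreover have "f \<in> U"
    using \<open>f (b i) < 1\<close> f by (simp add: U_def in_derived_set_of topspace_weak_star)
  ultimately obtain M where "M \<in> \<M>" "F M \<in> U" using f unfolding in_derived_set_of by blast
  then show False using F(2)[of M i] by (auto simp: U_def \<M>_def)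
qed

end

text \<open>The only limit point allowed by (I) is 0, whose values are below 1.\<close>

lemma I_polyhedral_imp_IV: "I_polyhedral X \<Longrightarrow> IV_polyhedral X"
  by (auto simp: I_polyhedral_def IV_polyhedral_def)

theorem theorem5p3:
  fixes \<A> :: "nat set set"
    and j :: "(nat \<Rightarrow> real) \<Rightarrow> 'v::real_normed_vector"
    and X :: "'v set"
  assumes "adequate \<A>"
    and "\<forall>A\<in>\<A>. finite A"
    and "is_h1 \<A> j X"
  shows "((\<forall>i. finite {A\<in>\<A>. i \<in> A}) \<longleftrightarrow> I_polyhedral X) \<and>
         (I_polyhedral X \<longleftrightarrow> IV_polyhedral X)"
proof -
  interpret h1_space \<A> j X using assms by unfold_locales auto
  show ?thesis
    using I_polyhedral_if_finite I_polyhedral_imp_IV finite_if_IV_polyhedral by blast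
qed

end
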